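(* For every nonnegative integer $N$, the following identity of polynomials in $x$ holds: $$H_N(x)=N!\,2^N\sum_{m=0}^{N}{}_{2}F_{2}\!\left(\begin{array}{c}-\frac12(N-m),\ -\frac12(N-m-1)\\ -\frac12 N,\ -\frac12(N-1)\end{array}\Bigg|\,-\frac14\right)\frac{(-N)_{m}}{m!}\,L_{m}(x),$$ where each ${}_2F_2$ denotes the terminating sum over $0\le t\le\lfloor (N-m)/2\rfloor$.
   Context: $(a)_0=1$ and $(a)_k=a(a+1)\cdots(a+k-1)$ denote the Pochhammer symbol. The symbol $${}_2F_2\!\left(\begin{array}{c}a_1,a_2\\ b_1,b_2\end{array}\Bigg|\,z\right)$$ stands for the sum of the terms $\frac{(a_1)_t(a_2)_t}{(b_1)_t(b_2)_t}\frac{z^t}{t!}$. In the claim one of the upper parameters is the nonpositive integer $-\lfloor (N-m)/2\rfloor$, and the sum is taken over $t=0,1,\dots,\lfloor (N-m)/2\rfloor$; in this range the denominators $(-\frac12N)_t(-\frac12(N-1))_t$ do not vanish. The Laguerre polynomials are $$L_n(x)=\sum_{k=0}^n\frac{(-n)_k}{k!}\frac{x^k}{k!}.$$ The (physicists') Hermite polynomials are $$H_N(x)=N!\sum_{k=0}^{\lfloor N/2\rfloor}\frac{(-1)^k}{k!\,(N-2k)!}(2x)^{N-2k}.$$ *)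

theory Defs
  imports "HOL-Computational_Algebra.Polynomial"
begin

text \<open>
  Terminating hypergeometric sum: the terms of \<open>2F2(a1, a2; b1, b2 | z)\<close> for indices
  \<open>0 \<le> t \<le> n\<close>. The truncation point \<open>n\<close> is explicit because for lower parameters that are
  nonpositive integers the denominators vanish beyond some index; there Isabelle's division
  by zero would yield 0, so only values of \<open>n\<close> below that index are meaningful.
\<close>

definition hyp2F2_upto :: "nat \<Rightarrow> 'a \<Rightarrow> 'a \<Rightarrow> 'a \<Rightarrow> 'a \<Rightarrow> 'a \<Rightarrow> 'a :: field_char_0" where
  "hyp2F2_upto n a1 a2 b1 b2 z =
     (\<Sum>t = 0..n. (pochhammer a1 t * pochhammer a2 t) / (pochhammer b1 t * pochhammer b2 t)
                   * (z ^ t / fact t))"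

definition laguerre_poly :: "nat \<Rightarrow> 'a :: field_char_0 poly" where
  "laguerre_poly n =
     (\<Sum>k = 0..n. smult (pochhammer (- of_nat n) k / fact k / fact k) (monom 1 k))"

text \<open>Physicists' normalisation; \<open>[:0, 2:]\<close> is the polynomial \<open>2x\<close>.\<close>

definition hermite_poly :: "nat \<Rightarrow> 'a :: field_char_0 poly" where
  "hermite_poly N =
     smult (fact N)
       (\<Sum>k = 0..N div 2. smult ((-1) ^ k / (fact k * fact (N - 2 * k))) ([:0, 2:] ^ (N - 2 * k)))"

end

theory Submission imports Defs begin

text \<open>
  Each product of a \<open>2F2\<close> with its coefficient \<open>(-N)\<^sub>m / m!\<close> equals
  \<open>\<Sum>t. (-1)\<^sup>m (N - 2t choose m) (-1/4)\<^sup>t / t!\<close>, because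
  \<open>(-a/2)\<^sub>t (-(a-1)/2)\<^sub>t = (-a)\<^sub>2\<^sub>t / 4\<^sup>t\<close>. Exchanging the sums over \<open>m\<close> and \<open>t\<close>,
  the sum over \<open>m\<close> is a binomial inversion of the Laguerre polynomials and yields
  \<open>x\<^sup>n / n!\<close> with \<open>n = N - 2t\<close>; what remains is the defining sum of the Hermite polynomial.
\<close>

lemma pochhammer_neg_of_nat:
  "pochhammer (- of_nat n :: 'a :: field_char_0) k = (-1) ^ k * of_nat (n choose k) * fact k"
  by (simp add: binomial_gbinomial gbinomial_pochhammer flip: power_mult_distrib)

text \<open>Duplication formula \<open>(2z)_(2t) = 4^t (z)_t (z + 1/2)_t\<close> at
  \<open>z = -a/2\<close>.\<close>

lemma pochhammer_half_mult:
  fixes a :: "'a :: field_char_0"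
  shows "pochhammer (- (1 / 2) * a) t * pochhammer (- (1 / 2) * (a - 1)) t
    = pochhammer (- a) (2 * t) / 4 ^ t"
proof -
  have "- (1 / 2) * (a - 1) = - (1 / 2) * a + 1 / 2"
    by (simp add: field_simps)
  moreover have "2 * (- (1 / 2) * a) = - a"
    by simp
  ultimately show ?thesis
    using pochhammer_double[of "- (1 / 2) * a" t] by (simp add: power_mult)
qed

lemma coeff_laguerre_poly:
  "coeff (laguerre_poly m :: 'a :: field_char_0 poly) k = (-1) ^ k * of_nat (m choose k) / fact k"
  by (simp add: laguerre_poly_def coeff_sum pochhammer_neg_of_nat if_distrib binomial_eq_0
      cong: if_cong)

text \<open>Trinomial revision pulls \<open>n choose k\<close> out of the sum and leaves the
  alternating sum of row \<open>n - k\<close> of Pascal's triangle, which vanishes unless that row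
  is row 0.\<close>

lemma sum_alternating_choose_mult_choose:
  "(\<Sum>m = 0..n. (-1) ^ m * of_nat (n choose m) * of_nat (m choose k))
    = (if k = n then (-1) ^ n else 0 :: 'a :: comm_ring_1)"
proof (cases "k \<le> n")
  case True
  have "(\<Sum>m = 0..n. (-1) ^ m * of_nat (n choose m) * of_nat (m choose k) :: 'a)
      = (\<Sum>m = k..n. (-1) ^ m * of_nat (n choose m) * of_nat (m choose k))"
    by (rule sum.mono_neutral_right) (auto simp: binomial_eq_0)
  also have "\<dots> = (\<Sum>m = k..n. (-1) ^ m * (of_nat (n choose k) * of_nat ((n - k) choose (m - k))))"
    by (rule sum.cong) (auto simp: mult.assoc choose_mult simp flip: of_nat_mult)
  also have "\<dots> = (\<Sum>j\<le>n - k. (-1) ^ (k + j) * (of_nat (n choose k) * of_nat ((n - k) choose j)))"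
    by (rule sum.reindex_bij_witness[of _ "\<lambda>j. k + j" "\<lambda>m. m - k"]) (use True in auto)
  also have "\<dots> = (-1) ^ k * of_nat (n choose k) * (\<Sum>j\<le>n - k. (-1) ^ j * of_nat ((n - k) choose j))"
    by (simp add: sum_distrib_left power_add mult_ac)
  also have "\<dots> = (if k = n then (-1) ^ n else 0)"
    using True choose_alternating_sum[of "n - k", where 'a = 'a] by auto
  finally show ?thesis .
qed (auto intro!: sum.neutral simp: binomial_eq_0)

text \<open>Coefficientwise this is the preceding orthogonality relation; at \<open>k = n\<close>
  the two signs \<open>(-1) ^ n\<close> cancel.\<close>

lemma sum_alternating_choose_laguerre_poly:
  "(\<Sum>m = 0..n. smult ((-1) ^ m * of_nat (n choose m)) (laguerre_poly m))
    = monom (1 / fact n :: 'a :: field_char_0) n"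
proof (rule poly_eqI)
  fix k
  have "coeff (\<Sum>m = 0..n. smult ((-1) ^ m * of_nat (n choose m)) (laguerre_poly m)) k
      = (-1) ^ k / fact k
        * (\<Sum>m = 0..n. (-1) ^ m * of_nat (n choose m) * of_nat (m choose k) :: 'a)"
    by (simp add: coeff_sum coeff_laguerre_poly sum_distrib_left mult_ac)
  also have "\<dots> = coeff (monom (1 / fact n :: 'a) n) k"
    by (simp add: sum_alternating_choose_mult_choose flip: power_mult_distrib)
  finally show "coeff (\<Sum>m = 0..n. smult ((-1) ^ m * of_nat (n choose m)) (laguerre_poly m)) k
      = coeff (monom (1 / fact n :: 'a) n) k" .
qed

lemma smult_sum_right: "smult c (\<Sum>i\<in>A. p i) = (\<Sum>i\<in>A. smult c (p i))"
  by (induction A rule: infinite_finite_induct) (simp_all add: smult_add_right)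

text \<open>In factorials both sides are \<open>(N-j)! / (m! (N-m-j)!)\<close>; the hypothesis keeps
  \<open>N choose j\<close> nonzero.\<close>

lemma choose_diff_swap:
  assumes "m + j \<le> N"
  shows "of_nat ((N - m) choose j) / of_nat (N choose j) * of_nat (N choose m)
    = (of_nat ((N - j) choose m) :: 'a :: field_char_0)"
proof -
  have "N - m - j = N - j - m"
    by simp
  then show ?thesis
    using assms by (simp add: binomial_fact field_simps)
qed

lemma hyp2F2_upto_mult_pochhammer:
  assumes "m \<le> N"
  shows "hyp2F2_upto ((N - m) div 2)
      (- (1 / 2) * (of_nat N - of_nat m)) (- (1 / 2) * (of_nat N - of_nat m - 1))
      (- (1 / 2) * of_nat N) (- (1 / 2) * (of_nat N - 1)) (- (1 / 4))
      * (pochhammer (- of_nat N) m / fact m)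
    = (\<Sum>t = 0..N div 2. (-1 / 4) ^ t / fact t * ((-1) ^ m * of_nat ((N - 2 * t) choose m))
        :: 'a :: field_char_0)" (is "?lhs = _")
proof -
  have *: "of_nat N - of_nat m = (of_nat (N - m) :: 'a)"
    using assms by (simp add: of_nat_diff)
  have "?lhs = (\<Sum>t = 0..(N - m) div 2.
      (-1 / 4) ^ t / fact t * ((-1) ^ m * of_nat ((N - 2 * t) choose m)))"
    unfolding hyp2F2_upto_def sum_distrib_right * pochhammer_half_mult
  proof (rule sum.cong)
    fix t assume "t \<in> {0..(N - m) div 2}"
    then have le: "m + 2 * t \<le> N"
      using assms by auto
    show "pochhammer (- of_nat (N - m)) (2 * t) / 4 ^ t / (pochhammer (- of_nat N) (2 * t) / 4 ^ t)
        * ((- (1 / 4)) ^ t / fact t) * (pochhammer (- of_nat N) m / fact m)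
      = (-1 / 4) ^ t / fact t * ((-1) ^ m * of_nat ((N - 2 * t) choose m) :: 'a)"
      \<comment> \<open>With \<open>j = 2 * t\<close>, the quotient of Pochhammer symbols is a
        quotient of binomials, as the signs, \<open>(2t)!\<close> and \<open>4 ^ t\<close>
        cancel.\<close>
      unfolding choose_diff_swap[OF le, symmetric]
      by (simp add: pochhammer_neg_of_nat mult_ac)
  qed simp
  \<comment> \<open>The added terms have \<open>N - 2 * t < m\<close>, so their binomials vanish.
    The range of \<open>t\<close> no longer depends on \<open>m\<close>, which lets the sums be
    exchanged.\<close>
  also have "\<dots> = (\<Sum>t = 0..N div 2.
      (-1 / 4) ^ t / fact t * ((-1) ^ m * of_nat ((N - 2 * t) choose m)))"
    by (rule sum.mono_neutral_left) auto
  finally show ?thesis .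
qed

theorem theorem3p2:
  fixes N :: nat
  shows "(hermite_poly N :: 'a :: field_char_0 poly) =
    smult (fact N * 2 ^ N)
      (\<Sum>m = 0..N.
        smult (hyp2F2_upto ((N - m) div 2)
                 (- (1 / 2) * (of_nat N - of_nat m)) (- (1 / 2) * (of_nat N - of_nat m - 1))
                 (- (1 / 2) * of_nat N) (- (1 / 2) * (of_nat N - 1))
                 (- (1 / 4))
               * (pochhammer (- of_nat N) m / fact m))
          (laguerre_poly m))"
    (is "_ = smult _ ?S")
proof -
  have "?S = (\<Sum>m = 0..N. \<Sum>t = 0..N div 2. smult ((-1 / 4) ^ t / fact t)
      (smult ((-1) ^ m * of_nat ((N - 2 * t) choose m)) (laguerre_poly m)))"
    by (rule sum.cong[OF refl], subst hyp2F2_upto_mult_pochhammer) (simp_all add: smult_sum)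
  also have "\<dots> = (\<Sum>t = 0..N div 2. smult ((-1 / 4) ^ t / fact t)
      (\<Sum>m = 0..N. smult ((-1) ^ m * of_nat ((N - 2 * t) choose m)) (laguerre_poly m)))"
    by (subst sum.swap) (simp add: smult_sum_right)
  \<comment> \<open>Binomials with \<open>m > N - 2 * t\<close> vanish; the inner sum becomes the
    inversion formula for \<open>n = N - 2 * t\<close>.\<close>
  also have "\<dots> = (\<Sum>t = 0..N div 2. smult ((-1 / 4) ^ t / fact t)
      (\<Sum>m = 0..N - 2 * t. smult ((-1) ^ m * of_nat ((N - 2 * t) choose m)) (laguerre_poly m)))"
    by (intro sum.cong refl arg_cong[where f = "smult _"] sum.mono_neutral_right) auto
  also have "\<dots> = (\<Sum>t = 0..N div 2. smult ((-1 / 4) ^ t / fact t)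
      (monom (1 / fact (N - 2 * t)) (N - 2 * t)))"
    by (simp only: sum_alternating_choose_laguerre_poly)
  finally have S: "?S = \<dots>" .
  have term_eq: "smult ((-1) ^ t / (fact t * fact (N - 2 * t))) ([:0, 2:] ^ (N - 2 * t))
      = smult (2 ^ N) (smult ((-1 / 4) ^ t / fact t)
          (monom (1 / fact (N - 2 * t) :: 'a) (N - 2 * t)))"
    if "t \<le> N div 2" for t
  proof -
    have "[:0, 2:] = monom (2 :: 'a) 1"
      by (simp add: monom_altdef)
    then have "[:0, 2:] ^ (N - 2 * t) = monom (2 ^ (N - 2 * t) :: 'a) (N - 2 * t)"
      by (simp add: monom_power)
    \<comment> \<open>The factor \<open>4 ^ t\<close> turns \<open>(-1/4) ^ t\<close> into the
      Hermite sign \<open>(-1) ^ t\<close>; the other factor is the coefficient of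
      \<open>(2x)^(N-2t)\<close>.\<close>
    moreover have "(2 :: 'a) ^ N = 2 ^ (N - 2 * t) * 4 ^ t"
    proof -
      have "(2 :: 'a) ^ N = 2 ^ (N - 2 * t + 2 * t)"
        using that by simp
      then show ?thesis
        by (simp only: power_add power_mult) simp
    qed
    ultimately show ?thesis
      by (simp add: smult_monom flip: power_mult_distrib)
  qed
  show ?thesis
    unfolding S hermite_poly_def smult_sum_right[of "fact N * 2 ^ N"] smult_sum_right[of "fact N"]
    by (rule sum.cong) (simp_all add: term_eq mult.assoc)
qed

end
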